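(* For positive integers $n$ and $i$, the number of accurate dominating sets of the path $P_n$ of cardinality $i$ satisfies $$d_a(P_n,i)\geq 2\,d(P_{n-3},i-2)-d(P_{n-6},i-4).$$
   Context: $P_m$ denotes the path on $m$ vertices. A dominating set of a graph $G=(V,E)$ is a set $D\subseteq V$ such that every vertex not in $D$ is adjacent to some vertex of $D$. A dominating set $D$ is accurate if no $|D|$-element subset of $V\setminus D$ is a dominating set of $G$. $d(G,j)$ is the number of dominating sets of $G$ of cardinality $j$ and $d_a(G,j)$ the number of accurate dominating sets of $G$ of cardinality $j$. *)

theory Defs
  imports Main
begin

text \<open>A finite simple graph is given by its vertex set and its set of edges, each edge being
  a two-element set of vertices.\<close>

type_synonym 'a graph = "'a set \<times> 'a set set"

definition verts :: "'a graph \<Rightarrow> 'a set" where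
  "verts G = fst G"

definition edges :: "'a graph \<Rightarrow> 'a set set" where
  "edges G = snd G"

definition adjacent :: "'a graph \<Rightarrow> 'a \<Rightarrow> 'a \<Rightarrow> bool" where
  "adjacent G u v \<longleftrightarrow> {u, v} \<in> edges G"

definition path_graph :: "nat \<Rightarrow> nat graph" where
  "path_graph m = ({1..m}, {{k, Suc k} | k. 1 \<le> k \<and> k < m})"

definition dominating_set :: "'a graph \<Rightarrow> 'a set \<Rightarrow> bool" where
  "dominating_set G D \<longleftrightarrow>
     D \<subseteq> verts G \<and> (\<forall>v \<in> verts G - D. \<exists>u \<in> D. adjacent G v u)"

definition accurate_dominating_set :: "'a graph \<Rightarrow> 'a set \<Rightarrow> bool" where
  "accurate_dominating_set G D \<longleftrightarrow>
     dominating_set G D \<and>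
     \<not> (\<exists>S. S \<subseteq> verts G - D \<and> card S = card D \<and> dominating_set G S)"

text \<open>Cardinalities are integers, so that the counts can be taken at \<open>i - 2\<close> and \<open>i - 4\<close>
  without truncated subtraction; at negative arguments they are 0.\<close>

definition num_dominating :: "'a graph \<Rightarrow> int \<Rightarrow> nat" where
  "num_dominating G j = card {D. dominating_set G D \<and> int (card D) = j}"

definition num_accurate_dominating :: "'a graph \<Rightarrow> int \<Rightarrow> nat" where
  "num_accurate_dominating G j = card {D. accurate_dominating_set G D \<and> int (card D) = j}"

text \<open>The number of dominating sets of size \<open>j\<close> of the path on \<open>m\<close> vertices, for an integer
  \<open>m\<close>. For negative \<open>m\<close> there is no such path and the count is 0. The path on 0 vertices is
  the null graph, whose only dominating set is the empty set. The two must be kept apart: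
  with the null graph in place of the paths of negative order, the inequality of the theorem
  would fail for \<open>n = 1\<close>, \<open>i = 2\<close>.\<close>

definition num_dominating_path :: "int \<Rightarrow> int \<Rightarrow> nat" where
  "num_dominating_path m j = (if m < 0 then 0 else num_dominating (path_graph (nat m)) j)"

end

theory Submission
  imports Defs
begin

text \<open>A dominating set containing both an end vertex and its neighbour is accurate, because no
  disjoint set dominates that end vertex. Adding the first two vertices to a dominating set of the
  path on the last \<open>n - 3\<close> vertices, or the last two to one of the path on the first \<open>n - 3\<close>,
  gives two families of such sets. For \<open>n \<ge> 6\<close> a common member omits the vertices \<open>3\<close> and \<open>n - 2\<close>,
  hence restricts to a dominating set of the middle \<open>n - 6\<close> vertices. For \<open>n \<le> 4\<close> the families are
  disjoint; for \<open>n = 5\<close> their only common member is \<open>{1, 2, 4, 5}\<close>, so \<open>i = 4\<close> is checked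
  separately.\<close>

section \<open>Domination in paths, by neighbouring vertices\<close>

text \<open>The end vertices need no separate cases: \<open>D\<close> lies in \<open>{1..m}\<close>,
  so it contains neither \<open>1 - 1 = 0\<close> nor \<open>Suc m\<close>.\<close>

lemma dominating_path_graph_iff:
  "dominating_set (path_graph m) D \<longleftrightarrow>
    D \<subseteq> {1..m} \<and> (\<forall>v\<in>{1..m}. v \<in> D \<or> v - 1 \<in> D \<or> Suc v \<in> D)"
proof (cases "D \<subseteq> {1..m}")
  case True
  have "(\<exists>u\<in>D. adjacent (path_graph m) v u) \<longleftrightarrow> v - 1 \<in> D \<or> Suc v \<in> D"
    if v: "v \<in> {1..m} - D" for v
  proof
    assume "\<exists>u\<in>D. adjacent (path_graph m) v u"
    then show "v - 1 \<in> D \<or> Suc v \<in> D"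
      by (auto simp: adjacent_def path_graph_def edges_def doubleton_eq_iff)
  next
    assume "v - 1 \<in> D \<or> Suc v \<in> D"
    then show "\<exists>u\<in>D. adjacent (path_graph m) v u"
    proof
      assume *: "v - 1 \<in> D"
      with True have "1 \<le> v - 1" by auto
      moreover have "{v, v - 1} = {v - 1, Suc (v - 1)}" using v by auto
      moreover have "v - 1 < m" using v by auto
      ultimately have "adjacent (path_graph m) v (v - 1)"
        unfolding adjacent_def path_graph_def edges_def by auto
      with * show ?thesis by blast
    next
      assume *: "Suc v \<in> D"
      with True have "v < m" by auto
      with v have "adjacent (path_graph m) v (Suc v)"
        unfolding adjacent_def path_graph_def edges_def by auto
      with * show ?thesis by blast
    qed
  qed
  with True show ?thesis
    by (auto simp: dominating_set_def path_graph_def verts_def)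
qed (auto simp: dominating_set_def path_graph_def verts_def)

lemma dominating_set_subset_path:
  "dominating_set (path_graph m) D \<Longrightarrow> D \<subseteq> {1..m}"
  by (simp add: dominating_path_graph_iff)

lemma finite_dominating_path: "finite {D. dominating_set (path_graph m) D \<and> P D}"
  by (rule finite_subset[of _ "Pow {1..m}"]) (use dominating_set_subset_path in blast, simp)

section \<open>Accuracy from an end vertex and its neighbour\<close>

lemma accurate_if_first_two:
  assumes "dominating_set (path_graph m) D" "{1, 2} \<subseteq> D"
  shows "accurate_dominating_set (path_graph m) D"
proof -
  have "\<not> dominating_set (path_graph m) S" if "S \<subseteq> {1..m} - D" for S
  proof
    assume S: "dominating_set (path_graph m) S"
    have "1 \<in> {1..m}" using assms dominating_set_subset_path by blast
    \<comment> \<open>Of the three candidates, \<open>1\<close> and \<open>2\<close> already lie in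
      \<open>D\<close>, and \<open>1 - 1\<close> is \<open>0\<close>, which is not a vertex.\<close>
    with S have "1 \<in> S \<or> 1 - 1 \<in> S \<or> Suc 1 \<in> S"
      unfolding dominating_path_graph_iff by blast
    with that assms(2) show False by (auto simp: numeral_2_eq_2)
  qed
  with assms show ?thesis
    by (auto simp: accurate_dominating_set_def path_graph_def verts_def)
qed

text \<open>Mirror image of the previous lemma. For \<open>m \<le> 1\<close> the truncated
  \<open>m - 1\<close> is \<open>0\<close>, so no dominating set meets the assumption.\<close>

lemma accurate_if_last_two:
  assumes "dominating_set (path_graph m) D" "{m - 1, m} \<subseteq> D"
  shows "accurate_dominating_set (path_graph m) D"
proof -
  have "\<not> dominating_set (path_graph m) S" if "S \<subseteq> {1..m} - D" for S
  proof
    assume S: "dominating_set (path_graph m) S"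
    have "m \<in> {1..m}" using assms dominating_set_subset_path by blast
    with S have "m \<in> S \<or> m - 1 \<in> S \<or> Suc m \<in> S"
      unfolding dominating_path_graph_iff by blast
    with that assms(2) show False by auto
  qed
  with assms show ?thesis
    by (auto simp: accurate_dominating_set_def path_graph_def verts_def)
qed

section \<open>Extension by three vertices, two of them chosen\<close>

text \<open>The pair \<open>{1, 2}\<close> takes care of the vertices 1, 2 and 3, and the shifted
  copy of \<open>D\<close> of all later ones.\<close>

lemma dominating_path_prepend:
  assumes "dominating_set (path_graph m) D"
  shows "dominating_set (path_graph (m + 3)) ({1, 2} \<union> (\<lambda>x. x + 3) ` D)"
proof -
  have D: "D \<subseteq> {1..m}" "\<And>v. v \<in> {1..m} \<Longrightarrow> v \<in> D \<or> v - 1 \<in> D \<or> Suc v \<in> D"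
    using assms by (auto simp: dominating_path_graph_iff)
  let ?F = "{1, 2} \<union> (\<lambda>x. x + 3) ` D"
  have "v \<in> ?F \<or> v - 1 \<in> ?F \<or> Suc v \<in> ?F" if v: "v \<in> {1..m + 3}" for v
  proof (cases "v \<le> 3")
    case True
    with v have "v = 1 \<or> v = 2 \<or> v = 3" by auto
    then show ?thesis by auto
  next
    case False
    then obtain w where w: "v = w + 3" "1 \<le> w"
      by (auto simp: not_le less_iff_Suc_add)
    with v D(2)[of w] have "w \<in> D \<or> w - 1 \<in> D \<or> Suc w \<in> D" by auto
    \<comment> \<open>The shift commutes with taking the predecessor because
      \<open>1 \<le> w\<close> rules out truncation.\<close>
    moreover have "v - 1 = (w - 1) + 3" "Suc v = Suc w + 3" using w by auto
    ultimately show ?thesis using w by blast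
  qed
  moreover have "?F \<subseteq> {1..m + 3}" using D(1) by auto
  ultimately show ?thesis unfolding dominating_path_graph_iff by blast
qed

lemma dominating_path_append:
  assumes "dominating_set (path_graph m) D"
  shows "dominating_set (path_graph (m + 3)) (D \<union> {m + 2, m + 3})"
proof -
  have D: "D \<subseteq> {1..m}" "\<And>v. v \<in> {1..m} \<Longrightarrow> v \<in> D \<or> v - 1 \<in> D \<or> Suc v \<in> D"
    using assms by (auto simp: dominating_path_graph_iff)
  let ?F = "D \<union> {m + 2, m + 3}"
  have "v \<in> ?F \<or> v - 1 \<in> ?F \<or> Suc v \<in> ?F" if v: "v \<in> {1..m + 3}" for v
  proof (cases "v \<le> m")
    case True
    with v D(2)[of v] show ?thesis by auto
  next
    case False
    with v have "v = m + 1 \<or> v = m + 2 \<or> v = m + 3" by auto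
    then show ?thesis by auto
  qed
  moreover have "?F \<subseteq> {1..m + 3}" using D(1) by auto
  ultimately show ?thesis unfolding dominating_path_graph_iff by blast
qed

lemma card_prepend:
  fixes D :: "nat set"
  assumes "finite D"
  shows "card ({1, 2} \<union> (\<lambda>x. x + 3) ` D) = card D + 2"
proof -
  have "{1, 2} \<inter> (\<lambda>x. x + 3) ` D = {}" by auto
  then show ?thesis using assms
    by (subst card_Un_disjoint) (auto simp: card_image inj_on_def)
qed

lemma card_append:
  assumes "D \<subseteq> {1..m::nat}"
  shows "card (D \<union> {m + 2, m + 3}) = card D + 2"
proof -
  have "D \<inter> {m + 2, m + 3} = {}" using assms by auto
  then show ?thesis using assms finite_subset
    by (subst card_Un_disjoint) auto
qed

lemma inj_on_prepend: "inj_on (\<lambda>D. {1, 2} \<union> (\<lambda>x. x + (3::nat)) ` D) A"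
proof (rule inj_on_inverseI)
  fix D :: "nat set"
  \<comment> \<open>Neither 1 nor 2 has the form \<open>x + 3\<close>, so the preimage under the
    shift recovers \<open>D\<close>.\<close>
  show "{x. x + 3 \<in> {1, 2} \<union> (\<lambda>x. x + 3) ` D} = D" by auto
qed

text \<open>The restriction to dominating sets places \<open>D\<close> inside \<open>{1..m}\<close>,
  so that intersecting with this interval removes exactly the added pair.\<close>

lemma inj_on_append: "inj_on (\<lambda>D. D \<union> {m + 2, m + 3}) {D. dominating_set (path_graph m) D \<and> P D}"
proof (rule inj_on_inverseI)
  fix D assume "D \<in> {D. dominating_set (path_graph m) D \<and> P D}"
  then have "D \<subseteq> {1..m}" using dominating_set_subset_path by blast
  then show "(D \<union> {m + 2, m + 3}) \<inter> {1..m} = D" by auto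
qed

section \<open>The overlap of the two families\<close>

text \<open>Here the long path has \<open>k + 6\<close> vertices, and \<open>C\<close> is its middle
  part shifted down by 3. The positions \<open>0\<close> and \<open>k + 1\<close> next to the middle
  are missing from \<open>D\<close>, so vertices in \<open>{1..k}\<close> can only be dominated from
  within \<open>C\<close>.\<close>

lemma prepend_eq_append_middle:
  assumes D: "dominating_set (path_graph (k + 3)) D"
    and E: "dominating_set (path_graph (k + 3)) E"
    and eq: "{1, 2} \<union> (\<lambda>x. x + 3) ` D = E \<union> {k + 5, k + 6}"
  obtains C where "dominating_set (path_graph k) C" "D = C \<union> {k + 2, k + 3}"
proof
  define C where "C = D \<inter> {1..k}"
  have sub: "D \<subseteq> {1..k + 3}" "E \<subseteq> {1..k + 3}"
    using D E dominating_set_subset_path by auto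
  have mem: "x \<in> D \<longleftrightarrow> x + 3 \<in> E \<union> {k + 5, k + 6}" for x
    unfolding eq[symmetric] by auto
  \<comment> \<open>Its shift \<open>k + 4\<close> falls in the gap between
    \<open>{1..k + 3}\<close>, which contains \<open>E\<close>, and the added pair.\<close>
  have "k + 1 \<notin> D" using mem[of "k + 1"] sub by auto
  moreover have last: "k + 2 \<in> D" "k + 3 \<in> D" by (simp_all add: mem)
  moreover have "x \<in> {1..k} \<or> x = k + 1 \<or> x = k + 2 \<or> x = k + 3" if "x \<in> D" for x
    using that sub(1) by fastforce
  ultimately show "D = C \<union> {k + 2, k + 3}" unfolding C_def by blast
  have "v \<in> C \<or> v - 1 \<in> C \<or> Suc v \<in> C" if v: "v \<in> {1..k}" for v
  proof -
    have "v \<in> D \<or> v - 1 \<in> D \<or> Suc v \<in> D"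
      using D v unfolding dominating_path_graph_iff by auto
    moreover have "v - 1 \<noteq> 0" if "v - 1 \<in> D" using that sub(1) by auto
    moreover have "Suc v \<noteq> k + 1" if "Suc v \<in> D" using that \<open>k + 1 \<notin> D\<close> by metis
    ultimately show ?thesis using v unfolding C_def by force
  qed
  then show "dominating_set (path_graph k) C"
    unfolding dominating_path_graph_iff C_def by blast
qed

text \<open>The excluded case really fails: for \<open>m = 2\<close>, \<open>j = 4\<close> the two
  families share \<open>{1, 2, 4, 5}\<close>, while the bound is 0 because \<open>int m - 3\<close>
  is negative.\<close>

lemma num_dominating_path_middle_ge:
  fixes m :: nat and j :: int
  defines "S \<equiv> {D. dominating_set (path_graph m) D \<and> int (card D) = j - 2}"
  assumes "\<not> (m = 2 \<and> j = 4)"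
  shows "card ((\<lambda>D. {1, 2} \<union> (\<lambda>x. x + 3) ` D) ` S \<inter> (\<lambda>D. D \<union> {m + 2, m + 3}) ` S)
    \<le> num_dominating_path (int m - 3) (j - 4)" (is "card ?X \<le> _")
proof (cases "m \<ge> 3")
  case True
  then obtain k where k: "m = k + 3" by (metis add.commute le_add_diff_inverse)
  let ?T = "{C. dominating_set (path_graph k) C \<and> int (card C) = j - 4}"
  \<comment> \<open>For an upper bound on \<open>card ?X\<close> it is enough to cover
    \<open>?X\<close> by an image of \<open>?T\<close>.\<close>
  have "?X \<subseteq> (\<lambda>C. {1, 2} \<union> (\<lambda>x. x + 3) ` (C \<union> {k + 2, k + 3})) ` ?T"
  proof
    fix X assume "X \<in> ?X"
    then obtain D E where DE: "D \<in> S" "E \<in> S" "X = {1, 2} \<union> (\<lambda>x. x + 3) ` D"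
      "X = E \<union> {k + 5, k + 6}" using k by (auto simp: numeral_eq_Suc)
    then obtain C where C: "dominating_set (path_graph k) C" "D = C \<union> {k + 2, k + 3}"
      using prepend_eq_append_middle[of k D E] by (auto simp: S_def k)
    have "card D = card C + 2"
      using C card_append[OF dominating_set_subset_path[OF C(1)]] by simp
    then have "C \<in> ?T" using C DE(1) by (simp add: S_def)
    then show "X \<in> (\<lambda>C. {1, 2} \<union> (\<lambda>x. x + 3) ` (C \<union> {k + 2, k + 3})) ` ?T"
      using C(2) DE(3) by blast
  qed
  then have "card ?X \<le> card ?T"
    by (rule surj_card_le[OF finite_dominating_path])
  then show ?thesis by (simp add: k num_dominating_path_def num_dominating_def)
next
  case False
  have "?X = {}"
  proof (rule ccontr)
    assume "?X \<noteq> {}"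
    then obtain D E where DE: "D \<in> S" "E \<in> S"
      and eq: "{1, 2} \<union> (\<lambda>x. x + 3) ` D = E \<union> {m + 2, m + 3}" by blast
    have sub: "D \<subseteq> {1..m}" "E \<subseteq> {1..m}"
      using DE dominating_set_subset_path by (auto simp: S_def)
    have mem: "y \<in> {1, 2} \<union> (\<lambda>x. x + 3) ` D \<longleftrightarrow> y \<in> E \<union> {m + 2, m + 3}" for y
      by (simp only: eq)
    from False consider "m = 0" | "m = 1" | "m = 2" by linarith
    then show False
    proof cases
      case 1
      with mem[of 1] sub show False by auto
    next
      case 2
      with mem[of 2] sub show False by auto
    next
      case 3
      have "1 \<in> E" "2 \<in> E" using mem[of 1] mem[of 2] 3 by auto
      moreover have "E \<subseteq> {1, 2}" using sub 3 by (auto simp: atLeastAtMost_iff)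
      ultimately have "E = {1, 2}" by blast
      then have "int (card E) = 2" by simp
      with DE(2) have "j = 4" by (simp add: S_def)
      with assms(2) 3 show False by simp
    qed
  qed
  then show ?thesis by simp
qed

theorem theorem3p6:
  fixes n i :: nat
  assumes "n \<ge> 1" and "i \<ge> 1"
  shows "int (num_accurate_dominating (path_graph n) (int i))
           \<ge> 2 * int (num_dominating_path (int n - 3) (int i - 2))
             - int (num_dominating_path (int n - 6) (int i - 4))"
proof (cases "n \<ge> 3")
  case False
  \<comment> \<open>Both path orders on the right are negative, so the right-hand side is 0.\<close>
  then show ?thesis by (simp add: num_dominating_path_def)
next
  case True
  then obtain m where n: "n = m + 3" by (metis add.commute le_add_diff_inverse)
  define S where "S = {D. dominating_set (path_graph m) D \<and> int (card D) = int i - 2}"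
  define A where "A = {D. accurate_dominating_set (path_graph n) D \<and> int (card D) = int i}"
  have finS: "finite S" unfolding S_def by (rule finite_dominating_path)
  have "A \<subseteq> {D. dominating_set (path_graph n) D \<and> True}"
    unfolding A_def accurate_dominating_set_def by blast
  then have finA: "finite A" by (rule finite_subset[OF _ finite_dominating_path])
  have dS: "num_dominating_path (int n - 3) (int i - 2) = card S"
    by (simp add: n num_dominating_path_def num_dominating_def S_def)
  have dA: "num_accurate_dominating (path_graph n) (int i) = card A"
    by (simp add: num_accurate_dominating_def A_def)
  show ?thesis
  proof (cases "m = 2 \<and> int i = 4")
    case True
    \<comment> \<open>For \<open>n = 5\<close>, \<open>i = 4\<close> the subtracted term is 0 and
      \<open>S\<close> has at most one member, so two accurate dominating sets suffice.\<close>
    have "{1..5} = {1, 2, 3, 4, 5::nat}" by auto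
    then have dom: "dominating_set (path_graph 5) {1, 2, 4, 5}"
        "dominating_set (path_graph 5) {1, 2, 3, 4}"
      unfolding dominating_path_graph_iff by auto
    have "{{1, 2, 4, 5}, {1, 2, 3, 4}} \<subseteq> A"
      using accurate_if_first_two[OF dom(1)] accurate_if_first_two[OF dom(2)] True
      by (simp add: A_def n)
    then have "card {{1, 2, 4, 5}, {1, 2, 3, 4::nat}} \<le> card A" by (rule card_mono[OF finA])
    moreover have "{1, 2, 4, 5} \<noteq> {1, 2, 3, 4::nat}" by auto
    ultimately have "2 \<le> card A" by (metis card_2_iff)
    moreover have "S \<subseteq> {{1, 2}}"
    proof
      fix D assume D: "D \<in> S"
      then have sub: "D \<subseteq> {1..2}" and "card D = 2"
        using True dominating_set_subset_path by (auto simp: S_def)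
      then have "D = {1..2}" by (intro card_subset_eq) auto
      moreover have "{1..2} = {1, 2::nat}" by auto
      ultimately show "D \<in> {{1, 2}}" by simp
    qed
    then have "card S \<le> 1" using card_mono[of "{{1, 2}}" S] by simp
    ultimately show ?thesis by (simp add: dS dA)
  next
    case False
    let ?f = "\<lambda>D. {1, 2} \<union> (\<lambda>x. x + (3::nat)) ` D" and ?g = "\<lambda>D. D \<union> {m + 2, m + 3}"
    have "?f D \<in> A" if "D \<in> S" for D
    proof -
      from that have D: "dominating_set (path_graph m) D" and c: "int (card D) = int i - 2"
        by (auto simp: S_def)
      have "finite D" using dominating_set_subset_path[OF D] finite_subset by blast
      then have "int (card (?f D)) = int i" using c by (simp only: card_prepend)
      then show ?thesis
        using accurate_if_first_two[OF dominating_path_prepend[OF D]] by (simp add: A_def n)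
    qed
    moreover have "?g D \<in> A" if "D \<in> S" for D
    proof -
      from that have D: "dominating_set (path_graph m) D" and c: "int (card D) = int i - 2"
        by (auto simp: S_def)
      have "int (card (?g D)) = int i"
        using c by (simp only: card_append[OF dominating_set_subset_path[OF D]])
      moreover have "accurate_dominating_set (path_graph (m + 3)) (?g D)"
        by (rule accurate_if_last_two[OF dominating_path_append[OF D]]) simp
      ultimately show ?thesis by (simp add: A_def n)
    qed
    ultimately have "?f ` S \<union> ?g ` S \<subseteq> A" by blast
    then have "card (?f ` S \<union> ?g ` S) \<le> card A" by (rule card_mono[OF finA])
    moreover have "card (?f ` S) = card S" by (rule card_image[OF inj_on_prepend])
    moreover have "card (?g ` S) = card S"
      unfolding S_def by (rule card_image[OF inj_on_append])
    \<comment> \<open>Inclusion-exclusion: the union has \<open>2 * card S\<close> members less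
      those of the overlap, which is bounded next.\<close>
    moreover have "card (?f ` S) + card (?g ` S)
        = card (?f ` S \<union> ?g ` S) + card (?f ` S \<inter> ?g ` S)"
      by (rule card_Un_Int) (simp_all add: finS)
    moreover have "card (?f ` S \<inter> ?g ` S) \<le> num_dominating_path (int m - 3) (int i - 4)"
      unfolding S_def by (rule num_dominating_path_middle_ge[OF False])
    moreover have "int n - 6 = int m - 3" by (simp add: n)
    ultimately show ?thesis unfolding dS dA by (simp del: of_nat_add)
  qed
qed

end
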